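(* For $z,x\in\mathbb C$ with $|x|<1$, $$\mathcal E(z,x)=2\,\mathcal O(z,x)^2.$$ Consequently, for every integer $N\ge1$, $$\sum_{a=0}^{N-1}\frac{\binom{2a}{a}\binom{2N-2a-2}{N-a-1}}{4^{N-1}(2a+1)(2N-2a-1)}P_a(z)P_{N-1-a}(z)=\frac{4^N}{2N^2\binom{2N}{N}}Q_N(z).$$ Equivalently, for every integer $N\ge1$ and every $m\ge0$, $$\sum_{a=0}^{N-1}\frac{\binom{2a}{a}\binom{2N-2a-2}{N-a-1}}{4^{N-1}(2a+1)(2N-2a-1)}\sum_{p=0}^{m}t_a(\{2\}^p)\,t_{N-1-a}(\{2\}^{m-p})=\frac{4^N}{2N^2\binom{2N}{N}}\,\zeta_{N-1}(\{2\}^{m}).$$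
   Context: Set $P_n(z):=\prod_{j=1}^{n}\left(1+\frac{z}{(2j-1)^2}\right)$ for $n\ge0$ and $Q_N(z):=\prod_{j=1}^{N-1}\left(1+\frac{z}{j^2}\right)$ for $N\ge1$. For $|x|<1$ define $$\mathcal O(z,x):=\sum_{n=0}^{\infty}\frac{\binom{2n}{n}}{4^n(2n+1)}P_n(z)x^{2n+1},\qquad \mathcal E(z,x):=\sum_{n=1}^{\infty}\frac{4^n}{n^2\binom{2n}{n}}Q_n(z)x^{2n}.$$ For integers $n\ge0$, $m\ge0$, the finite repeated-$2$ sums are $$\zeta_n(\{2\}^m):=\sum_{n\ge n_1>\cdots>n_m\ge1}\frac1{n_1^2\cdots n_m^2},\qquad t_n(\{2\}^m):=\sum_{n\ge n_1>\cdots>n_m\ge1}\frac1{(2n_1-1)^2\cdots(2n_m-1)^2},$$ with the value $1$ when $m=0$ and the value $0$ when $m>n$. *)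

theory Defs
  imports "HOL-Analysis.Analysis"
begin

definition Pprod :: "nat \<Rightarrow> complex \<Rightarrow> complex" where
  "Pprod n z = (\<Prod>j=1..n. 1 + z / (2 * of_nat j - 1)\<^sup>2)"

text \<open>Only \<open>N \<ge> 1\<close> is meant; \<open>Qprod 0\<close> is an artefact of truncated subtraction and is never used.\<close>

definition Qprod :: "nat \<Rightarrow> complex \<Rightarrow> complex" where
  "Qprod N z = (\<Prod>j=1..N - 1. 1 + z / (of_nat j)\<^sup>2)"

definition calO_term :: "complex \<Rightarrow> complex \<Rightarrow> nat \<Rightarrow> complex" where
  "calO_term z x n =
     of_nat (2 * n choose n) / (4 ^ n * (2 * of_nat n + 1)) * Pprod n z * x ^ (2 * n + 1)"

definition calE_term :: "complex \<Rightarrow> complex \<Rightarrow> nat \<Rightarrow> complex" where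
  "calE_term z x n =
     4 ^ n / ((of_nat n)\<^sup>2 * of_nat (2 * n choose n)) * Qprod n z * x ^ (2 * n)"

text \<open>Meaningful for \<open>norm x < 1\<close> only; there both series converge
  (\<open>summable_calO\<close> and \<open>summable_calE\<close> below). The series for \<open>calE\<close> starts at \<open>n = 1\<close>,
  hence the shifted index.\<close>

definition calO :: "complex \<Rightarrow> complex \<Rightarrow> complex" where
  "calO z x = (\<Sum>n. calO_term z x n)"

definition calE :: "complex \<Rightarrow> complex \<Rightarrow> complex" where
  "calE z x = (\<Sum>n. calE_term z x (Suc n))"

text \<open>The index tuples \<open>n \<ge> n\<^sub>1 > \<dots> > n\<^sub>m \<ge> 1\<close>, as lists.\<close>

definition chains :: "nat \<Rightarrow> nat \<Rightarrow> nat list set" where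
  "chains n m = {ns. length ns = m \<and> sorted_wrt (>) ns \<and> set ns \<subseteq> {1..n}}"

definition zeta2 :: "nat \<Rightarrow> nat \<Rightarrow> real" where
  "zeta2 n m = (\<Sum>ns\<in>chains n m. 1 / (\<Prod>k\<leftarrow>ns. (real k)\<^sup>2))"

definition t2 :: "nat \<Rightarrow> nat \<Rightarrow> real" where
  "t2 n m = (\<Sum>ns\<in>chains n m. 1 / (\<Prod>k\<leftarrow>ns. (2 * real k - 1)\<^sup>2))"

lemma finite_chains: "finite (chains n m)"
  unfolding chains_def
  by (rule finite_subset[OF _ finite_lists_length_eq[of "{1..n}" m]]) auto

lemma chains_0: "chains n 0 = {[]}"
  by (auto simp: chains_def)

lemma chains_empty:
  assumes "m > n"
  shows "chains n m = {}"
proof -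
  have False if "ns \<in> chains n m" for ns
  proof -
    have *: "length ns = m" "sorted_wrt (>) ns" "set ns \<subseteq> {1..n}"
      using that by (auto simp: chains_def)
    have "distinct ns"
      using *(2) by (induction ns) auto
    then have "m = card (set ns)"
      using *(1) by (simp add: distinct_card)
    also have "\<dots> \<le> n"
      using card_mono[OF _ *(3)] by simp
    finally show False using assms by simp
  qed
  then show ?thesis by blast
qed

lemma zeta2_0: "zeta2 n 0 = 1" and t2_0: "t2 n 0 = 1"
  by (simp_all add: zeta2_def t2_def chains_0)

lemma zeta2_eq_0: "m > n \<Longrightarrow> zeta2 n m = 0" and t2_eq_0: "m > n \<Longrightarrow> t2 n m = 0"
  by (simp_all add: zeta2_def t2_def chains_empty)

lemma central_binomial_Suc:
  "(of_nat n + 1) * of_nat (2 * Suc n choose Suc n) =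
     2 * (2 * of_nat n + 1) * (of_nat (2 * n choose n) :: complex)"
proof -
  have "Suc n * (2 * Suc n choose Suc n) = 2 * Suc n * (Suc (2 * n) choose n)"
    using Suc_times_binomial_eq[of "Suc (2 * n)" n] by (simp add: algebra_simps)
  moreover have "Suc n * (Suc (2 * n) choose n) = Suc (2 * n) * (2 * n choose n)"
    using Suc_times_binomial_eq[of "2 * n" n] binomial_symmetric[of n "Suc (2 * n)"]
    by (simp add: mult.commute Suc_diff_le)
  ultimately have "Suc n * (2 * Suc n choose Suc n) = 2 * (Suc (2 * n) * (2 * n choose n))"
    by (metis mult.assoc)
  then have "(of_nat (Suc n * (2 * Suc n choose Suc n)) :: complex) =
      of_nat (2 * (Suc (2 * n) * (2 * n choose n)))"
    by (rule arg_cong)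
  then show ?thesis
    by (simp only: of_nat_mult of_nat_Suc of_nat_numeral) (simp add: algebra_simps)
qed

lemma summable_aux:
  fixes f r :: "nat \<Rightarrow> complex"
  assumes x: "norm (x :: complex) < 1"
    and step: "\<And>n. f (Suc n) = of_real (r' n) * (1 + z / (of_nat (Suc n + k n))\<^sup>2) * x\<^sup>2 * f n"
    and r': "\<And>n. 0 \<le> r' n" "\<And>n. r' n \<le> 1"
  shows "summable f"
proof -
  obtain c where c: "(norm x)\<^sup>2 < c" "c < 1"
    using x dense[of "(norm x)\<^sup>2" 1] by (auto simp: power_less_one_iff abs_square_less_1)
  have "(\<lambda>n. (1 + norm z / (real (Suc n))\<^sup>2) * (norm x)\<^sup>2) \<longlonglongrightarrow> (1 + 0) * (norm x)\<^sup>2"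
    by (intro tendsto_intros real_tendsto_divide_at_top filterlim_pow_at_top
        filterlim_compose[OF filterlim_real_sequentially filterlim_Suc]) auto
  then have "eventually (\<lambda>n. (1 + norm z / (real (Suc n))\<^sup>2) * (norm x)\<^sup>2 < c) sequentially"
    using c(1) by (intro order_tendstoD(2)) auto
  then obtain N where N: "\<And>n. n \<ge> N \<Longrightarrow> (1 + norm z / (real (Suc n))\<^sup>2) * (norm x)\<^sup>2 < c"
    by (auto simp: eventually_sequentially)
  show ?thesis
  proof (rule summable_ratio_test[OF c(2)])
    fix n assume "n \<ge> N"
    have "norm (1 + z / (of_nat (Suc n + k n))\<^sup>2) \<le> 1 + norm z / (real (Suc n + k n))\<^sup>2"
      by (rule order_trans[OF norm_triangle_ineq]) (simp add: norm_divide norm_power del: of_nat_add of_nat_Suc)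
    also have "\<dots> \<le> 1 + norm z / (real (Suc n))\<^sup>2"
      by (intro add_left_mono divide_left_mono power_mono) auto
    finally have 1: "norm (1 + z / (of_nat (Suc n + k n))\<^sup>2) \<le> 1 + norm z / (real (Suc n))\<^sup>2" .
    have "norm (f (Suc n)) =
        r' n * norm (1 + z / (of_nat (Suc n + k n))\<^sup>2) * (norm x)\<^sup>2 * norm (f n)"
      using r'(1)[of n] by (simp only: step norm_mult norm_power norm_of_real abs_of_nonneg)
    also have "\<dots> \<le> 1 * (1 + norm z / (real (Suc n))\<^sup>2) * (norm x)\<^sup>2 * norm (f n)"
      using 1 r' by (intro mult_right_mono mult_mono) auto
    also have "\<dots> \<le> c * norm (f n)"
      using N[OF \<open>n \<ge> N\<close>] by (intro mult_right_mono) auto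
    finally show "norm (f (Suc n)) \<le> c * norm (f n)" .
  qed
qed

lemma aux1:
  fixes a b c q s :: complex
  assumes "a \<noteq> 0" "c \<noteq> 0" "s \<noteq> 0"
  shows "2 * a * b / s / (4 * q * c) = a\<^sup>2 / (2 * s * c) * (b / (q * a))"
  using assms by (simp add: field_simps power2_eq_square)

lemma aux2:
  fixes b c d q s :: complex
  assumes "b \<noteq> 0" "c \<noteq> 0" "d \<noteq> 0" "s \<noteq> 0"
  shows "4 * q / (d\<^sup>2 * (2 * c * b / d)) = 2 * s\<^sup>2 / (d * c) * (q / (s\<^sup>2 * b))"
  using assms by (simp add: field_simps power2_eq_square)

lemma summable_calO:
  assumes "norm x < 1"
  shows "summable (calO_term z x)"
proof (rule summable_aux[OF assms])
  fix n
  let ?r = "(2 * real n + 1)\<^sup>2 / ((2 * real n + 2) * (2 * real n + 3))"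
  show "0 \<le> ?r" by simp
  show "?r \<le> 1" by (rule divide_le_eq_1_pos[THEN iffD2]) ((intro mult_pos_pos add_nonneg_pos; simp), simp add: power2_eq_square algebra_simps)
  let ?B = "of_nat (2 * n choose n) :: complex"
  let ?B' = "of_nat (2 * Suc n choose Suc n) :: complex"
  have nz: "of_nat n + 1 \<noteq> (0 :: complex)" "2 * of_nat n + 1 \<noteq> (0 :: complex)"
      "2 * of_nat n + 3 \<noteq> (0 :: complex)"
    using of_nat_neq_0[of n, where 'a = complex] of_nat_neq_0[of "2 * n", where 'a = complex]
      of_nat_neq_0[of "2 * n + 2", where 'a = complex] by (simp_all add: add.commute)
  have B': "?B' = 2 * (2 * of_nat n + 1) * ?B / (of_nat n + 1)"
    using central_binomial_Suc[of n] nz by (simp add: field_simps)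
  have P: "Pprod (Suc n) z = Pprod n z * (1 + z / (of_nat (Suc n + n))\<^sup>2)"
    by (simp add: Pprod_def algebra_simps)
  have r: "of_real ?r = (2 * of_nat n + 1)\<^sup>2 / (2 * (of_nat n + 1) * (2 * of_nat n + 3 :: complex))"
    by (simp add: algebra_simps)
  have "?B' / (4 ^ Suc n * (2 * of_nat (Suc n) + 1)) =
      of_real ?r * (?B / (4 ^ n * (2 * of_nat n + 1)))"
  proof -
    have "2 * of_nat (Suc n) + 1 = (2 * of_nat n + 3 :: complex)" by simp
    then show ?thesis
      unfolding B' r power_Suc by (simp only: aux1[OF nz(2,3,1)])
  qed
  then show "calO_term z x (Suc n) =
      of_real ?r * (1 + z / (of_nat (Suc n + n))\<^sup>2) * x\<^sup>2 * calO_term z x n"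
    unfolding calO_term_def P by (simp add: power2_eq_square mult_ac del: of_nat_Suc of_nat_add)
qed

lemma summable_calE:
  assumes "norm x < 1"
  shows "summable (\<lambda>n. calE_term z x (Suc n))"
proof (rule summable_aux[OF assms])
  fix n
  let ?r = "2 * (real n + 1)\<^sup>2 / ((real n + 2) * (2 * real n + 3))"
  show "0 \<le> ?r" by simp
  show "?r \<le> 1" by (rule divide_le_eq_1_pos[THEN iffD2]) ((intro mult_pos_pos add_nonneg_pos; simp), simp add: power2_eq_square algebra_simps)
  let ?B = "of_nat (2 * Suc n choose Suc n) :: complex"
  let ?B' = "of_nat (2 * Suc (Suc n) choose Suc (Suc n)) :: complex"
  have nz: "of_nat n + 1 \<noteq> (0 :: complex)" "of_nat n + 2 \<noteq> (0 :: complex)"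
      "2 * of_nat n + 3 \<noteq> (0 :: complex)"
    using of_nat_neq_0[of n, where 'a = complex] of_nat_neq_0[of "n + 1", where 'a = complex]
      of_nat_neq_0[of "2 * n + 2", where 'a = complex] by (simp_all add: add.commute)
  have B: "?B \<noteq> 0" by (simp del: binomial_Suc_Suc mult_Suc_right)
  have "(of_nat (Suc n) + 1) * ?B' = 2 * (2 * of_nat (Suc n) + 1) * ?B"
    by (rule central_binomial_Suc)
  then have "(of_nat n + 2) * ?B' = 2 * (2 * of_nat n + 3) * ?B"
    by (simp add: add.commute del: binomial_Suc_Suc mult_Suc_right)
  then have B': "?B' = 2 * (2 * of_nat n + 3) * ?B / (of_nat n + 2)"
    using nz by (simp add: field_simps del: binomial_Suc_Suc mult_Suc_right)
  have Q: "Qprod (Suc (Suc n)) z = Qprod (Suc n) z * (1 + z / (of_nat (Suc n + 0))\<^sup>2)"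
    by (simp add: Qprod_def)
  have r: "of_real ?r = 2 * (of_nat n + 1)\<^sup>2 / ((of_nat n + 2) * (2 * of_nat n + 3 :: complex))"
    by simp
  have "4 ^ Suc (Suc n) / ((of_nat (Suc (Suc n)))\<^sup>2 * ?B') =
      of_real ?r * (4 ^ Suc n / ((of_nat (Suc n))\<^sup>2 * ?B))"
  proof -
    have "of_nat (Suc (Suc n)) = (of_nat n + 2 :: complex)"
         "of_nat (Suc n) = (of_nat n + 1 :: complex)" by simp_all
    then show ?thesis
      unfolding B' r power_Suc[of 4 "Suc n"] by (simp only: aux2[OF B nz(3,2,1)])
  qed
  then show "calE_term z x (Suc (Suc n)) =
      of_real ?r * (1 + z / (of_nat (Suc n + 0))\<^sup>2) * x\<^sup>2 * calE_term z x (Suc n)"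
    unfolding calE_term_def Q
    by (simp add: power2_eq_square mult_ac del: of_nat_Suc of_nat_add binomial_Suc_Suc)
qed

end

theory Submission
  imports Defs
begin

text \<open>
  Write \<open>\<O>(z,x) = x H(x\<^sup>2)\<close>. The coefficient recurrence of \<open>H\<close> says that \<open>y = \<O>(z,x)\<close> solves
  \<open>(1 - x\<^sup>2) y'' - x y' = z y\<close> (formally \<open>y = sinh (\<surd>z arcsin x) / \<surd>z\<close>), whence the first integral
  \<open>(1 - x\<^sup>2) y'\<^sup>2 - z y\<^sup>2 = 1\<close>. Together they give \<open>(1 - x\<^sup>2) g'' - x g' = 4 z g + 4\<close> for
  \<open>g = 2 y\<^sup>2\<close>, which is the coefficient recurrence of \<open>\<E>(z,x)\<close>. All of this is done with formal power
  series in the variable \<open>X = x\<^sup>2\<close>. The finite sums are the coefficients of \<open>P\<^sub>n\<close> and \<open>Q\<^sub>N\<close>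
  as polynomials in \<open>z\<close>.
\<close>

unbundle no vec_syntax
unbundle fps_syntax

section \<open>Coefficient recurrences of the two series\<close>

definition O_coeff :: "complex \<Rightarrow> nat \<Rightarrow> complex" where
  "O_coeff z n = of_nat (2 * n choose n) / (4 ^ n * (2 * of_nat n + 1)) * Pprod n z"

definition E_coeff :: "complex \<Rightarrow> nat \<Rightarrow> complex" where
  "E_coeff z n = 4 ^ n / ((of_nat n)\<^sup>2 * of_nat (2 * n choose n)) * Qprod n z"

lemma of_nat_affine_neq_0:
  "of_nat n + 1 \<noteq> (0 :: complex)" "2 * of_nat n + 1 \<noteq> (0 :: complex)"
  "2 * of_nat n + 3 \<noteq> (0 :: complex)"
  using of_nat_neq_0[of n, where 'a = complex] of_nat_neq_0[of "2 * n", where 'a = complex]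
    of_nat_neq_0[of "2 * n + 2", where 'a = complex] by (simp_all add: add.commute)

lemma O_coeff_0: "O_coeff z 0 = 1"
  by (simp add: O_coeff_def Pprod_def)

lemma O_coeff_Suc:
  "(2 * of_nat n + 3) * (2 * of_nat n + 2) * O_coeff z (Suc n) =
     ((2 * of_nat n + 1)\<^sup>2 + z) * O_coeff z n"
proof -
  define s where "s = (of_nat n :: complex)"
  define B where "B = (of_nat (2 * n choose n) :: complex)"
  define B' where "B' = (of_nat (2 * Suc n choose Suc n) :: complex)"
  have nz: "s + 1 \<noteq> 0" "2 * s + 1 \<noteq> 0" "2 * s + 3 \<noteq> 0"
    unfolding s_def by (rule of_nat_affine_neq_0)+
  have B': "B' = 2 * (2 * s + 1) * B / (s + 1)"
    using central_binomial_Suc[of n] nz by (simp add: field_simps B_def B'_def s_def)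
  have P: "Pprod (Suc n) z = Pprod n z * (1 + z / (2 * s + 1)\<^sup>2)"
    by (simp add: Pprod_def s_def algebra_simps)
  have "O_coeff z (Suc n) = B' / (4 * 4 ^ n * (2 * s + 3)) * Pprod (Suc n) z"
    by (simp add: O_coeff_def B'_def s_def algebra_simps del: binomial_Suc_Suc mult_Suc_right)
  \<comment> \<open>The square \<open>(2 * s + 1)\<^sup>2\<close> is split off to absorb the
    denominator of the new factor of \<open>Pprod\<close>.\<close>
  also have "(2 * s + 3) * (2 * s + 2) * \<dots> =
      ((2 * s + 1)\<^sup>2 * (1 + z / (2 * s + 1)\<^sup>2)) * (B / (4 ^ n * (2 * s + 1)) * Pprod n z)"
    unfolding B' P using nz by (simp add: divide_simps) (simp add: algebra_simps power2_eq_square)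
  also have "(2 * s + 1)\<^sup>2 * (1 + z / (2 * s + 1)\<^sup>2) = (2 * s + 1)\<^sup>2 + z"
    using nz by (simp add: field_simps)
  finally show ?thesis
    by (simp add: O_coeff_def B_def s_def)
qed

lemma E_coeff_1: "E_coeff z (Suc 0) = 2"
  by (simp add: E_coeff_def Qprod_def)

text \<open>It fails at n = 0: division by zero makes \<open>E_coeff z 0\<close> vanish, while
  \<open>E_coeff z (Suc 0)\<close> is 2. Hence the separate initial value.\<close>

lemma E_coeff_Suc:
  assumes "n \<ge> 1"
  shows "(2 * of_nat n + 2) * (2 * of_nat n + 1) * E_coeff z (Suc n) =
     4 * ((of_nat n)\<^sup>2 + z) * E_coeff z n"
proof -
  define s where "s = (of_nat n :: complex)"
  define B where "B = (of_nat (2 * n choose n) :: complex)"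
  define B' where "B' = (of_nat (2 * Suc n choose Suc n) :: complex)"
  have nz: "s + 1 \<noteq> 0" "2 * s + 1 \<noteq> 0" "s \<noteq> 0" "B \<noteq> 0"
    using of_nat_affine_neq_0[of n] assms by (auto simp: s_def B_def)
  \<comment> \<open>This is twice \<open>2 * s + 1\<close>, in two shapes that simplification may
    give the denominator.\<close>
  have nz2: "2 + s * 4 \<noteq> 0" "2 + 4 * s \<noteq> 0"
  proof -
    have "2 * (2 * s + 1) \<noteq> 0"
      using nz(2) by (intro no_zero_divisors) simp_all
    then show "2 + s * 4 \<noteq> 0" "2 + 4 * s \<noteq> 0"
      by (simp_all add: algebra_simps)
  qed
  have B': "B' = 2 * (2 * s + 1) * B / (s + 1)"
    using central_binomial_Suc[of n] nz by (simp add: field_simps B_def B'_def s_def)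
  obtain m where m: "n = Suc m" using assms by (cases n) auto
  have Q: "Qprod (Suc n) z = Qprod n z * (1 + z / s\<^sup>2)"
    by (simp add: Qprod_def s_def m)
  have "E_coeff z (Suc n) = 4 * 4 ^ n / ((s + 1)\<^sup>2 * B') * Qprod (Suc n) z"
    by (simp add: E_coeff_def B'_def s_def add.commute del: binomial_Suc_Suc mult_Suc_right)
  also have "(2 * s + 2) * (2 * s + 1) * \<dots> =
      4 * (s\<^sup>2 * (1 + z / s\<^sup>2)) * (4 ^ n / (s\<^sup>2 * B) * Qprod n z)"
    unfolding B' Q using nz nz2 by (simp add: divide_simps) (simp add: algebra_simps power2_eq_square)
  also have "s\<^sup>2 * (1 + z / s\<^sup>2) = s\<^sup>2 + z"
    using nz by (simp add: field_simps)
  finally show ?thesis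
    by (simp add: E_coeff_def B_def s_def)
qed

section \<open>Differential equations in the variable X\<close>

text \<open>For y = x H(X) with X = x^2 one has y' = H + 2 X H' and y'' = x (6 H' + 4 X H'').
  Inserting these into (1 - x^2) y'' - x y' - z y = 0 and dividing by x gives this equation.\<close>

lemma fps_O_coeff_ODE:
  fixes z :: complex
  defines "H \<equiv> Abs_fps (O_coeff z)"
  shows "4 * fps_X * (1 - fps_X) * fps_deriv (fps_deriv H) + (6 - 8 * fps_X) * fps_deriv H
    - (1 + fps_const z) * H = 0"
proof (rule fps_ext)
  fix n
  have eq: "4 * fps_X * (1 - fps_X) * fps_deriv (fps_deriv H) + (6 - 8 * fps_X) * fps_deriv H
      - (1 + fps_const z) * H =
    fps_const 4 * (fps_X * fps_deriv (fps_deriv H))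
    - fps_const 4 * (fps_X * (fps_X * fps_deriv (fps_deriv H))) + fps_const 6 * fps_deriv H
    - fps_const 8 * (fps_X * fps_deriv H) - H - fps_const z * H"
    by (simp add: algebra_simps flip: numeral_fps_const)
  have rec: "(2 * of_nat n + 3) * (2 * of_nat n + 2) * H $ Suc n =
     ((2 * of_nat n + 1)\<^sup>2 + z) * H $ n"
    using O_coeff_Suc[of n z] by (simp add: H_def)
  show "(4 * fps_X * (1 - fps_X) * fps_deriv (fps_deriv H) + (6 - 8 * fps_X) * fps_deriv H
      - (1 + fps_const z) * H) $ n = 0 $ n"
  proof (cases n)
    case 0
    then show ?thesis using rec unfolding eq by (simp add: algebra_simps)
  next
    case (Suc m)
    show ?thesis
      using rec unfolding eq Suc
      \<comment> \<open>The term with X^2 H'' reaches two indices down, so its coefficient at n = 1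
        vanishes separately.\<close>
      by (cases m) (simp_all add: algebra_simps power2_eq_square)
  qed
qed

text \<open>Since \<open>y' = H + 2 X H'\<close>, this is the first integral in the variable \<open>X\<close>.\<close>

lemma fps_O_coeff_invariant:
  fixes z :: complex
  defines "H \<equiv> Abs_fps (O_coeff z)"
  shows "(1 - fps_X) * (H + 2 * fps_X * fps_deriv H)\<^sup>2 - fps_const z * fps_X * H\<^sup>2 = 1"
    (is "?I = 1")
proof -
  have num: "fps_deriv (numeral k :: complex fps) = 0" for k
    by (simp add: numeral_fps_const)
  \<comment> \<open>In x, the derivative of (1 - x^2) y'^2 - z y^2 is 2 y' ((1 - x^2) y'' - x y' - z
    y), that is 2 x y' times the left side of the equation for H. Passing to d/dX divides by 2
    x.\<close>
  have "fps_deriv ?I = (H + 2 * fps_X * fps_deriv H) *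
      (4 * fps_X * (1 - fps_X) * fps_deriv (fps_deriv H) + (6 - 8 * fps_X) * fps_deriv H
    - (1 + fps_const z) * H)"
    by (simp add: power2_eq_square num algebra_simps)
  then have "fps_deriv ?I = 0"
    using fps_O_coeff_ODE[of z] by (simp add: H_def)
  then have "?I = fps_const (?I $ 0)"
    by (simp only: fps_deriv_eq_0_iff)
  moreover have "?I $ 0 = 1"
    by (simp add: power2_eq_square H_def O_coeff_0 fps_mult_nth_0)
  ultimately show ?thesis by simp
qed

text \<open>With g(x) = G(x^2), g' = 2 x G' and g'' = 4 X G'' + 2 G', so this is the equation for g
  = 2 y^2.\<close>

lemma fps_O_coeff_square_ODE:
  fixes z :: complex
  defines "G \<equiv> 2 * fps_X * (Abs_fps (O_coeff z))\<^sup>2"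
  shows "(1 - fps_X) * (4 * fps_X * fps_deriv (fps_deriv G) + 2 * fps_deriv G)
    - 2 * fps_X * fps_deriv G = 4 * fps_const z * G + 4"
proof -
  define H where "H = Abs_fps (O_coeff z)"
  define D where "D = 4 * fps_X * (1 - fps_X) * fps_deriv (fps_deriv H)
    + (6 - 8 * fps_X) * fps_deriv H - (1 + fps_const z) * H"
  define I where "I = (1 - fps_X) * (H + 2 * fps_X * fps_deriv H)\<^sup>2 - fps_const z * fps_X * H\<^sup>2"
  have num: "fps_deriv (numeral k :: complex fps) = 0" for k
    by (simp add: numeral_fps_const)
  \<comment> \<open>From g'' = 4 y'^2 + 4 y y'': the y'^2 part with half of 4 z g forms 4 I; the
    rest is 4 y times the equation for y, which is 4 X H D.\<close>
  have "(1 - fps_X) * (4 * fps_X * fps_deriv (fps_deriv G) + 2 * fps_deriv G)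
      - 2 * fps_X * fps_deriv G - 4 * fps_const z * G = 4 * I + 4 * fps_X * H * D"
    unfolding G_def I_def D_def H_def[symmetric]
    by (simp add: power2_eq_square num algebra_simps)
  moreover have "D = 0" "I = 1"
    unfolding D_def I_def H_def by (rule fps_O_coeff_ODE fps_O_coeff_invariant)+
  ultimately show ?thesis
    by (subst add.commute, intro iffD1[OF diff_eq_eq]) simp
qed

lemma fps_O_coeff_square_nth:
  fixes z :: complex
  defines "G \<equiv> 2 * fps_X * (Abs_fps (O_coeff z))\<^sup>2"
  shows "G $ Suc n = E_coeff z (Suc n)"
proof -
  have G0: "G $ 0 = 0" by (simp add: G_def)
  \<comment> \<open>The inhomogeneity 4 enters only at n = 0; as \<open>G $ 0\<close> is 0, it
    forces \<open>G $ 1\<close> to be 2. Afterwards this is the recurrence of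
    \<open>E_coeff\<close>.\<close>
  have rec: "(2 * of_nat n + 2) * (2 * of_nat n + 1) * G $ Suc n =
      4 * ((of_nat n)\<^sup>2 + z) * G $ n + (if n = 0 then 4 else 0)" for n
  proof -
    have "fps_const 4 * (fps_X * fps_deriv (fps_deriv G)) + fps_const 2 * fps_deriv G
      - fps_const 4 * (fps_X * (fps_X * fps_deriv (fps_deriv G)))
      - fps_const 4 * (fps_X * fps_deriv G) = fps_const (4 * z) * G + fps_const 4"
      using fps_O_coeff_square_ODE[of z, folded G_def]
      by (simp add: algebra_simps flip: numeral_fps_const fps_const_mult)
    then have "(fps_const 4 * (fps_X * fps_deriv (fps_deriv G)) + fps_const 2 * fps_deriv G
      - fps_const 4 * (fps_X * (fps_X * fps_deriv (fps_deriv G)))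
      - fps_const 4 * (fps_X * fps_deriv G)) $ n = (fps_const (4 * z) * G + fps_const 4) $ n"
      by (rule arg_cong)
    then show ?thesis
    proof (cases n)
      case (Suc m)
      with \<open>_ $ n = _ $ n\<close> show ?thesis
        by (cases m) (simp_all add: algebra_simps power2_eq_square)
    qed (simp add: G0)
  qed
  show ?thesis
  proof (induction n)
    case 0
    show ?case using rec[of 0] by (simp add: G0 E_coeff_1)
  next
    case (Suc n)
    have "(2 * of_nat (Suc n) + 2) * (2 * of_nat (Suc n) + 1) * G $ Suc (Suc n) =
        (2 * of_nat (Suc n) + 2) * (2 * of_nat (Suc n) + 1) * E_coeff z (Suc (Suc n))"
      using rec[of "Suc n"] E_coeff_Suc[of "Suc n" z] Suc by (simp del: of_nat_Suc)
    moreover have "(2 * of_nat (Suc n) + 2) * (2 * of_nat (Suc n) + 1) \<noteq> (0 :: complex)"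
      using of_nat_affine_neq_0[of "Suc n"] by (metis mult_eq_0_iff distrib_left mult_numeral_1_right numeral_One zero_neq_numeral)
    ultimately show ?case by (simp only: mult_cancel_left) simp
  qed
qed

lemma O_coeff_convolution:
  "(\<Sum>a\<le>n. O_coeff z a * O_coeff z (n - a)) = E_coeff z (Suc n) / 2"
proof -
  have "(2 * fps_X * (Abs_fps (O_coeff z))\<^sup>2) $ Suc n =
      2 * (\<Sum>a\<le>n. O_coeff z a * O_coeff z (n - a))"
    by (simp add: mult.assoc numeral_fps_const power2_eq_square)
       (simp add: fps_mult_nth atMost_atLeast0)
  then show ?thesis
    by (simp add: fps_O_coeff_square_nth)
qed

section \<open>From formal to convergent series\<close>

text \<open>Convergence at a real r between |x| and 1 gives absolute convergence at x^2, as the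
  Cauchy product requires.\<close>

lemma O_coeff_powser_abs_summable:
  assumes "norm x < 1"
  shows "summable (\<lambda>n. norm (O_coeff z n * (x\<^sup>2) ^ n))"
proof -
  obtain r where r: "norm x < r" "r < 1"
    using assms dense by blast
  then have "r > 0" using norm_ge_zero[of x] by linarith
  have "summable (calO_term z (of_real r))"
    using r \<open>r > 0\<close> by (intro summable_calO) auto
  also have "calO_term z (of_real r) = (\<lambda>n. of_real r * (O_coeff z n * of_real (r\<^sup>2) ^ n))"
    by (simp add: fun_eq_iff calO_term_def O_coeff_def power_mult)
  finally have "summable (\<lambda>n. O_coeff z n * of_real (r\<^sup>2) ^ n)"
    using \<open>r > 0\<close> by (simp add: summable_cmult_iff)
  then show ?thesis
    by (rule powser_insidea) (use r \<open>r > 0\<close> in \<open>auto simp: norm_power intro!: power_strict_mono\<close>)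
qed

lemma calE_eq_calO_square:
  assumes "norm x < 1"
  shows "calE z x = 2 * (calO z x)\<^sup>2"
proof -
  define a where "a n = O_coeff z n * (x\<^sup>2) ^ n" for n
  have abs: "summable (\<lambda>n. norm (a n))"
    unfolding a_def by (rule O_coeff_powser_abs_summable[OF assms])
  have "c * p * x ^ (2 * n + 1) = x * (c * p * (x\<^sup>2) ^ n)" for c p n
    by (simp add: power_mult)
  then have "calO z x = (\<Sum>n. x * a n)"
    unfolding calO_def calO_term_def O_coeff_def a_def by (simp only:)
  also have "\<dots> = x * (\<Sum>n. a n)"
    by (rule suminf_mult[OF summable_norm_cancel[OF abs]])
  finally have O: "calO z x = x * (\<Sum>n. a n)" .
  have "(\<lambda>n. \<Sum>i\<le>n. a i * a (n - i)) sums ((\<Sum>n. a n) * (\<Sum>n. a n))"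
    using abs abs by (rule Cauchy_product_sums)
  then have "(\<lambda>n. 2 * x\<^sup>2 * (\<Sum>i\<le>n. a i * a (n - i))) sums (2 * x\<^sup>2 * ((\<Sum>n. a n) * (\<Sum>n. a n)))"
    by (rule sums_mult)
  \<comment> \<open>The factor x^2 comes from the two odd series and moves the index from n to n +
    1, where \<open>calE\<close> starts.\<close>
  moreover have "2 * x\<^sup>2 * (\<Sum>i\<le>n. a i * a (n - i)) = calE_term z x (Suc n)" for n
  proof -
    have "(\<Sum>i\<le>n. a i * a (n - i)) = (\<Sum>i\<le>n. O_coeff z i * O_coeff z (n - i) * (x\<^sup>2) ^ n)"
    proof (intro sum.cong refl)
      fix i assume "i \<in> {..n}"
      then have "(x\<^sup>2) ^ n = (x\<^sup>2) ^ i * (x\<^sup>2) ^ (n - i)"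
        by (simp flip: power_add)
      then show "a i * a (n - i) = O_coeff z i * O_coeff z (n - i) * (x\<^sup>2) ^ n"
        by (simp only: a_def mult_ac)
    qed
    also have "\<dots> = E_coeff z (Suc n) / 2 * (x\<^sup>2) ^ n"
      by (simp add: O_coeff_convolution flip: sum_distrib_right)
    finally have "2 * x\<^sup>2 * (\<Sum>i\<le>n. a i * a (n - i)) = E_coeff z (Suc n) * (x\<^sup>2) ^ Suc n"
      by (simp add: mult.commute)
    then show ?thesis
      by (simp only: calE_term_def E_coeff_def power_mult)
  qed
  ultimately have "calE z x = 2 * x\<^sup>2 * ((\<Sum>n. a n) * (\<Sum>n. a n))"
    unfolding calE_def by (simp only: sums_iff)
  then show ?thesis
    by (simp only: O power2_eq_square mult_ac)
qed

section \<open>Finite repeated sums as polynomial coefficients\<close>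

text \<open>A decreasing tuple can contain the largest admissible index only as its head.\<close>

lemma chains_Suc_Suc:
  "chains (Suc n) (Suc m) = chains n (Suc m) \<union> (#) (Suc n) ` chains n m"
proof (intro set_eqI iffI)
  fix ns assume ns: "ns \<in> chains (Suc n) (Suc m)"
  then obtain k ks where k: "ns = k # ks" by (cases ns) (auto simp: chains_def)
  with ns have *: "length ks = m" "\<forall>j\<in>set ks. j < k" "sorted_wrt (>) ks"
      "1 \<le> k" "k \<le> Suc n" "set ks \<subseteq> {1..Suc n}"
    by (auto simp: chains_def)
  show "ns \<in> chains n (Suc m) \<union> (#) (Suc n) ` chains n m"
  proof (cases "k = Suc n")
    case True
    then have "ks \<in> chains n m" using * by (fastforce simp: chains_def)
    then show ?thesis using True k by auto
  next
    case False
    then have "ns \<in> chains n (Suc m)" using * k by (fastforce simp: chains_def)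
    then show ?thesis by auto
  qed
qed (fastforce simp: chains_def)+

text \<open>These are the elementary symmetric polynomials of the weights. A new linear factor
  splits a coefficient just as \<open>chains_Suc_Suc\<close> splits the tuples.\<close>

lemma coeff_prod_linear_chains:
  fixes w :: "nat \<Rightarrow> 'a :: comm_ring_1"
  shows "coeff (\<Prod>j=1..n. [:1, w j:]) m = (\<Sum>ns\<in>chains n m. \<Prod>k\<leftarrow>ns. w k)"
proof (induction n arbitrary: m)
  case 0
  show ?case
    by (cases "m = 0") (simp_all add: chains_0 chains_empty coeff_1)
next
  case (Suc n)
  show ?case
  proof (cases m)
    case 0
    then show ?thesis using Suc[of 0] by (simp add: chains_0 coeff_mult)
  next
    case (Suc l)
    have disj: "chains n (Suc l) \<inter> (#) (Suc n) ` chains n l = {}"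
      by (auto simp: chains_def)
    have "coeff (\<Prod>j=1..Suc n. [:1, w j:]) (Suc l) =
        coeff (\<Prod>j=1..n. [:1, w j:]) (Suc l) + w (Suc n) * coeff (\<Prod>j=1..n. [:1, w j:]) l"
      by (simp add: mult.commute[of _ "[:1, _:]"])
    also have "\<dots> = (\<Sum>ns\<in>chains (Suc n) (Suc l). \<Prod>k\<leftarrow>ns. w k)"
      unfolding chains_Suc_Suc Suc.IH
      by (subst sum.union_disjoint)
         (auto simp: finite_chains disj sum.reindex sum_distrib_left)
    finally show ?thesis by (simp only: Suc)
  qed
qed

definition P_poly :: "nat \<Rightarrow> complex poly" where
  "P_poly n = (\<Prod>j=1..n. [:1, 1 / (2 * of_nat j - 1)\<^sup>2:])"

text \<open>The index counts factors, so \<open>Qprod N\<close> corresponds to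
  \<open>Q_poly (N - 1)\<close>.\<close>

definition Q_poly :: "nat \<Rightarrow> complex poly" where
  "Q_poly n = (\<Prod>j=1..n. [:1, 1 / (of_nat j)\<^sup>2:])"

lemma poly_P_poly: "poly (P_poly n) z = Pprod n z"
  by (simp add: P_poly_def Pprod_def poly_prod)

lemma poly_Q_poly: "poly (Q_poly (N - 1)) z = Qprod N z"
  by (simp add: Q_poly_def Qprod_def poly_prod)

lemma of_real_inverse_prod_list:
  "of_real (1 / (\<Prod>k\<leftarrow>ns. f k)) = (\<Prod>k\<leftarrow>ns. 1 / of_real (f k) :: complex)"
proof (induction ns)
  case (Cons k ns)
  then show ?case by (simp flip: Cons)
qed simp

lemma coeff_P_poly: "coeff (P_poly n) m = of_real (t2 n m)"
  unfolding P_poly_def coeff_prod_linear_chains t2_def of_real_sum of_real_inverse_prod_list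
  by simp

lemma coeff_Q_poly: "coeff (Q_poly n) m = of_real (zeta2 n m)"
  unfolding Q_poly_def coeff_prod_linear_chains zeta2_def of_real_sum of_real_inverse_prod_list
  by simp

section \<open>The finite convolution identities\<close>

text \<open>Real values let one weight serve the real identity and, through \<open>of_real\<close>,
  the complex one.\<close>

definition conv_weight :: "nat \<Rightarrow> nat \<Rightarrow> real" where
  "conv_weight N a = real (2 * a choose a) * real ((2 * N - 2 * a - 2) choose (N - a - 1)) /
     (4 ^ (N - 1) * real (2 * a + 1) * real (2 * N - 2 * a - 1))"

lemma Pprod_convolution:
  assumes "N \<ge> 1"
  shows "(\<Sum>a=0..N - 1. of_real (conv_weight N a) * Pprod a z * Pprod (N - 1 - a) z) =
    4 ^ N / (2 * (of_nat N)\<^sup>2 * of_nat (2 * N choose N)) * Qprod N z"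
proof -
  obtain n where N: "N = Suc n" using assms by (cases N) auto
  have "of_real (conv_weight N a) * Pprod a z * Pprod (N - 1 - a) z =
      O_coeff z a * O_coeff z (n - a)" if "a \<le> n" for a
  proof -
    \<comment> \<open>Writing n = a + b removes the truncated subtractions.\<close>
    define b where "b = n - a"
    have n: "n = a + b" using that by (simp add: b_def)
    have "2 * N - 2 * a - 2 = 2 * b" "N - a - 1 = b" "2 * N - 2 * a - 1 = 2 * b + 1" "N - 1 = a + b"
      by (simp_all add: N n)
    then show ?thesis
      by (simp add: conv_weight_def O_coeff_def n power_add) (simp add: ac_simps)
  qed
  then have "(\<Sum>a=0..N - 1. of_real (conv_weight N a) * Pprod a z * Pprod (N - 1 - a) z) =
      (\<Sum>a\<le>n. O_coeff z a * O_coeff z (n - a))"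
    by (intro sum.cong) (auto simp: N)
  then show ?thesis
    unfolding O_coeff_convolution by (simp only: E_coeff_def N) simp
qed

text \<open>\<open>Pprod_convolution\<close> holds for every complex z, hence as an identity of
  polynomials; this compares the coefficients of z^m.\<close>

lemma t2_convolution:
  assumes "N \<ge> 1"
  shows "(\<Sum>a=0..N - 1. conv_weight N a * (\<Sum>p=0..m. t2 a p * t2 (N - 1 - a) (m - p))) =
    4 ^ N / (2 * (real N)\<^sup>2 * real (2 * N choose N)) * zeta2 (N - 1) m"
proof -
  define q :: real where "q = 4 ^ N / (2 * (real N)\<^sup>2 * real (2 * N choose N))"
  let ?S = "\<Sum>a=0..N - 1. smult (of_real (conv_weight N a)) (P_poly a * P_poly (N - 1 - a))"
  have q: "complex_of_real q = 4 ^ N / (2 * (of_nat N)\<^sup>2 * of_nat (2 * N choose N))"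
    by (simp add: q_def)
  have "poly ?S = poly (smult (of_real q) (Q_poly (N - 1)))"
    unfolding q
    by (rule ext)
       (simp only: poly_sum poly_smult poly_mult poly_P_poly poly_Q_poly mult.assoc[symmetric]
         Pprod_convolution[OF assms])
  then have "?S = smult (of_real q) (Q_poly (N - 1))"
    by (simp only: poly_eq_poly_eq_iff)
  then have "coeff ?S m = coeff (smult (of_real q) (Q_poly (N - 1))) m"
    by (rule arg_cong)
  then have "complex_of_real (\<Sum>a=0..N - 1. conv_weight N a * (\<Sum>p=0..m. t2 a p * t2 (N - 1 - a) (m - p))) =
      of_real (q * zeta2 (N - 1) m)"
    by (simp add: coeff_sum coeff_mult coeff_P_poly coeff_Q_poly atMost_atLeast0)
  then show ?thesis
    unfolding of_real_eq_iff q_def .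
qed

theorem theorem3p1:
  shows "(\<forall>(z::complex) (x::complex). norm x < 1 \<longrightarrow> calE z x = 2 * (calO z x)\<^sup>2) \<and>
    (\<forall>(z::complex) (N::nat). N \<ge> 1 \<longrightarrow>
      (\<Sum>a=0..N - 1.
          of_nat (2 * a choose a) * of_nat ((2 * N - 2 * a - 2) choose (N - a - 1)) /
          (4 ^ (N - 1) * of_nat (2 * a + 1) * of_nat (2 * N - 2 * a - 1)) *
          Pprod a z * Pprod (N - 1 - a) z) =
        4 ^ N / (2 * (of_nat N)\<^sup>2 * of_nat (2 * N choose N)) * Qprod N z) \<and>
    (\<forall>(N::nat) (m::nat). N \<ge> 1 \<longrightarrow>
      (\<Sum>a=0..N - 1.
          real (2 * a choose a) * real ((2 * N - 2 * a - 2) choose (N - a - 1)) /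
          (4 ^ (N - 1) * real (2 * a + 1) * real (2 * N - 2 * a - 1)) *
          (\<Sum>p=0..m. t2 a p * t2 (N - 1 - a) (m - p))) =
        4 ^ N / (2 * (real N)\<^sup>2 * real (2 * N choose N)) * zeta2 (N - 1) m)"
proof (intro conjI allI impI)
  fix z x :: complex assume "norm x < 1"
  then show "calE z x = 2 * (calO z x)\<^sup>2" by (rule calE_eq_calO_square)
next
  fix z :: complex and N :: nat assume "N \<ge> 1"
  from Pprod_convolution[OF this, of z]
  show "(\<Sum>a=0..N - 1.
          of_nat (2 * a choose a) * of_nat ((2 * N - 2 * a - 2) choose (N - a - 1)) /
          (4 ^ (N - 1) * of_nat (2 * a + 1) * of_nat (2 * N - 2 * a - 1)) *
          Pprod a z * Pprod (N - 1 - a) z) =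
        4 ^ N / (2 * (of_nat N)\<^sup>2 * of_nat (2 * N choose N)) * Qprod N z"
    by (simp only: conv_weight_def of_real_divide of_real_mult of_real_power of_real_numeral of_real_of_nat_eq)
next
  fix N m :: nat assume "N \<ge> 1"
  from t2_convolution[OF this, of m]
  show "(\<Sum>a=0..N - 1.
          real (2 * a choose a) * real ((2 * N - 2 * a - 2) choose (N - a - 1)) /
          (4 ^ (N - 1) * real (2 * a + 1) * real (2 * N - 2 * a - 1)) *
          (\<Sum>p=0..m. t2 a p * t2 (N - 1 - a) (m - p))) =
        4 ^ N / (2 * (real N)\<^sup>2 * real (2 * N choose N)) * zeta2 (N - 1) m"
    unfolding conv_weight_def .
qed

end
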